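(* Let $(\mathcal{T},\theta)$ be a stratified and balanced staged tree. Then its associated multipartition matrix $A_{\mathcal{T}}$ satisfies the generalized running intersection property (GRIP).
   Context: Staged trees: $\mathcal{T}=(V,E)$ is a finite directed rooted tree (every root-to-leaf path is directed away from the root) with at least one edge, with a surjective labeling $\theta:E\to S$ onto a label set $S$. For $v\in V$, $\mathrm{ch}(v)$ is the set of children of $v$, $E(v)$ the set of outgoing edges, and the floret of $v$ is $\mathcal{F}_v=\{\theta(e):e\in E(v)\}$. $(\mathcal{T},\theta)$ is a staged tree if for each $v$ no two edges in $E(v)$ have the same label, and for all $v,w\in V$ the sets $\mathcal{F}_v,\mathcal{F}_w$ are equal or disjoint. The level of a vertex $v$ is the number of edges in the root-to-$v$ path. The staged tree is stratified if all leaves have the same level and $\mathcal{F}_v=\mathcal{F}_w$ implies that $v$ and $w$ have the same level; the level of the tree is the level of its leaves. Balanced: for $v\in V$ let $\Lambda_v$ be the set of $v$-to-leaf paths and $t(v)=\sum_{\lambda\in\Lambda_v}\prod_{e\in\lambda}\theta(e)$, a polynomial in the labels (so $t(v)=1$ for a leaf). The staged tree is balanced if for any $v,w\in V$ with $\mathcal{F}_v=\mathcal{F}_w$, $t(v')t(w'')=t(w')t(v'')$ for all distinct $v',v''\in\mathrm{ch}(v)$ and distinct $w',w''\in\mathrm{ch}(w)$ with $\theta(v,v')=\theta(w,w')$ and $\theta(v,v'')=\theta(w,w'')$. Associated matrix: for a stratified staged tree of level $k$, $A_{\mathcal{T}}=A^{1,\dots,k}$ is the $0/1$ matrix with one column for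 each root-to-leaf path and one row for each label; the entry is $1$ if the label occurs on the path. The partition $A^\ell$ consists of the rows of labels of edges going from a vertex of level $\ell-1$ to a vertex of level $\ell$. Partition and multipartition matrices: a partition matrix with $m$ columns is a $0/1$ matrix each of whose columns has exactly one entry equal to $1$, with no zero rows. A multipartition matrix $A=A^{1,\dots,k}$ is the stacking of partition matrices $A^1,\dots,A^k$ with $m$ columns. Write $[r]=\{1,\dots,r\}$; $a^\ell_i$ is the $i$-th row of $A^\ell$ and $I^\ell_i$ its support. $A^{1,\dots,\ell}$ is the stacking of the first $\ell$ partitions, and $c^\ell_j$ the number of columns of $A^{1,\dots,\ell}$ equal to its $j$-th column (the $j$-th included). Well-connected: $A$ is well-connected if for every row $a^\ell_u$ with $\ell>1$ one has $c^\ell_j/c^{\ell-1}_j=c^\ell_{j'}/c^{\ell-1}_{j'}$ for all $j,j'\in I^\ell_u$. The matrix $\Cup_{n=1}^{\ell}A^n$: let $\beta$ be the number of distinct columns of $A^{1,\dots,\ell}$ and $\lambda:[m]\to[\beta]$ a surjective labeling with $\lambda(j)=\lambda(j')$ iff the $j$-th and $j'$-th columns of $A^{1,\dots,\ell}$ are equal. Then $\Cup_{n=1}^{\ell}A^n$ is the $\beta\times m$ partition matrix whose $j$-th column is the standard basis vector $e_{\lambda(j)}$. Matrix florets: let $B,C$ be partition matrices with $m$ columns; $BC$ denotes $B$ stacked above $C$ (a multipartition matrix with two partitions). A row of $B$ and a row of $C$ are connected if their supports intersect. $BC$ satisfies the floret condition if for any two rows of $B$, the sets of rows of $C$ connected to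 them are disjoint or equal. In that case the set of rows of $C$ connected to a given row of $B$ is a floret of $C$; let $\mathcal{F}^C_1,\dots,\mathcal{F}^C_f$ be the distinct florets of $C$. $B\Cap C$ is the $f\times m$ matrix whose $(t,j)$ entry is $1$ if the row of $C$ having $j$ in its support lies in $\mathcal{F}^C_t$, and $0$ otherwise. GRIP: with $B_\ell=\Cup_{n=1}^{\ell}A^n$, the matrix $A^{1,\dots,k}$ satisfies the GRIP if for each $\ell\in[k-1]$: (1) $B_\ell A^{\ell+1}$ is well-connected; (2) $B_\ell A^{\ell+1}$ satisfies the floret condition; (3) the rows of $B_\ell\Cap A^{\ell+1}$ lie in the rowspan of $A^{1,\dots,\ell}$. *)

theory Defs
  imports "HOL-Library.Poly_Mapping" "HOL-Library.FuncSet" Complex_Main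
    "Graph_Theory.Graph_Theory"
begin

section \<open>Matrices with named rows and columns\<close>

text \<open>
  Rows and columns are indexed by arbitrary finite sets instead of initial segments of the
  naturals: the rows of the matrix of a staged tree are its labels and the columns its
  root-to-leaf paths, and no order on either is needed.  Values of \<open>entry\<close> outside
  \<open>rows \<times> cols\<close> carry no meaning.
\<close>

record ('r, 'c) imatrix =
  rows :: "'r set"
  cols :: "'c set"
  entry :: "'r \<Rightarrow> 'c \<Rightarrow> real"

definition row :: "('r, 'c) imatrix \<Rightarrow> 'r \<Rightarrow> 'c \<Rightarrow> real" where
  "row M i = restrict (entry M i) (cols M)"

definition column :: "('r, 'c) imatrix \<Rightarrow> 'c \<Rightarrow> 'r \<Rightarrow> real" where
  "column M j = restrict (\<lambda>i. entry M i j) (rows M)"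

definition rowspan :: "('r, 'c) imatrix \<Rightarrow> ('c \<Rightarrow> real) set" where
  "rowspan M = {restrict (\<lambda>j. \<Sum>i\<in>rows M. x i * entry M i j) (cols M) | x. True}"

definition support :: "('r, 'c) imatrix \<Rightarrow> 'r \<Rightarrow> 'c set" where
  "support M i = {j \<in> cols M. entry M i j \<noteq> 0}"

definition partition_matrix :: "('r, 'c) imatrix \<Rightarrow> bool" where
  "partition_matrix M \<longleftrightarrow>
     finite (rows M) \<and> finite (cols M) \<and>
     (\<forall>i\<in>rows M. \<forall>j\<in>cols M. entry M i j \<in> {0, 1}) \<and>
     (\<forall>j\<in>cols M. \<exists>!i. i \<in> rows M \<and> entry M i j = 1) \<and>
     (\<forall>i\<in>rows M. \<exists>j\<in>cols M. entry M i j \<noteq> 0)"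

section \<open>Multipartition matrices\<close>

text \<open>
  A multipartition matrix \<open>A\<^sup>1\<^sup>,\<^sup>\<dots>\<^sup>,\<^sup>k\<close> is represented by the family of its partitions
  \<open>A 1, \<dots>, A k\<close>; values of \<open>A\<close> at other indices carry no meaning.
\<close>

definition multipartition_matrix :: "nat \<Rightarrow> (nat \<Rightarrow> ('r, 'c) imatrix) \<Rightarrow> bool" where
  "multipartition_matrix k A \<longleftrightarrow>
     (\<forall>l\<in>{1..k}. partition_matrix (A l) \<and> cols (A l) = cols (A 1))"

text \<open>The matrix \<open>A\<^sup>1\<^sup>,\<^sup>\<dots>\<^sup>,\<^sup>l\<close>, for \<open>l \<ge> 1\<close>; its row \<open>(n, i)\<close> is row \<open>i\<close> of \<open>A n\<close>.\<close>

definition stack :: "(nat \<Rightarrow> ('r, 'c) imatrix) \<Rightarrow> nat \<Rightarrow> (nat \<times> 'r, 'c) imatrix" where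
  "stack A l =
     \<lparr>rows = (SIGMA n:{1..l}. rows (A n)), cols = cols (A 1), entry = (\<lambda>(n, i). entry (A n) i)\<rparr>"

definition col_mult :: "(nat \<Rightarrow> ('r, 'c) imatrix) \<Rightarrow> nat \<Rightarrow> 'c \<Rightarrow> nat" where
  "col_mult A l j =
     card {j' \<in> cols (stack A l). column (stack A l) j' = column (stack A l) j}"

definition well_connected :: "nat \<Rightarrow> (nat \<Rightarrow> ('r, 'c) imatrix) \<Rightarrow> bool" where
  "well_connected k A \<longleftrightarrow>
     (\<forall>l\<in>{2..k}. \<forall>u\<in>rows (A l). \<forall>j\<in>support (A l) u. \<forall>j'\<in>support (A l) u.
        real (col_mult A l j) / real (col_mult A (l - 1) j) =
        real (col_mult A l j') / real (col_mult A (l - 1) j'))"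

text \<open>
  The labelling \<open>\<lambda>\<close> of the distinct columns of \<open>A\<^sup>1\<^sup>,\<^sup>\<dots>\<^sup>,\<^sup>l\<close> is
  taken to be \<open>column (stack A l)\<close> itself, so that the rows are indexed by the distinct columns.
\<close>

definition big_cup :: "(nat \<Rightarrow> ('r, 'c) imatrix) \<Rightarrow> nat \<Rightarrow> (nat \<times> 'r \<Rightarrow> real, 'c) imatrix" where
  "big_cup A l =
     \<lparr>rows = column (stack A l) ` cols (stack A l), cols = cols (stack A l),
      entry = (\<lambda>b j. if column (stack A l) j = b then 1 else 0)\<rparr>"

section \<open>Matrix florets\<close>

definition map_rows :: "('r \<Rightarrow> 'q) \<Rightarrow> ('r, 'c) imatrix \<Rightarrow> ('q, 'c) imatrix" where
  "map_rows f M =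
     \<lparr>rows = f ` rows M, cols = cols M, entry = (\<lambda>q. entry M (inv_into (rows M) f q))\<rparr>"

text \<open>
  The matrix \<open>BC\<close> as a family of two partitions.  The injections serve only
  to give the rows of \<open>B\<close> and \<open>C\<close> a common index type.
\<close>

definition stack2 ::
    "('p, 'c) imatrix \<Rightarrow> ('q, 'c) imatrix \<Rightarrow> nat \<Rightarrow> ('p + 'q, 'c) imatrix" where
  "stack2 B C l = (if l = 1 then map_rows Inl B else map_rows Inr C)"

definition connected_rows :: "('p, 'c) imatrix \<Rightarrow> ('q, 'c) imatrix \<Rightarrow> 'p \<Rightarrow> 'q \<Rightarrow> bool" where
  "connected_rows B C b c \<longleftrightarrow> support B b \<inter> support C c \<noteq> {}"

definition row_floret :: "('p, 'c) imatrix \<Rightarrow> ('q, 'c) imatrix \<Rightarrow> 'p \<Rightarrow> 'q set" where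
  "row_floret B C b = {c \<in> rows C. connected_rows B C b c}"

definition floret_condition :: "('p, 'c) imatrix \<Rightarrow> ('q, 'c) imatrix \<Rightarrow> bool" where
  "floret_condition B C \<longleftrightarrow>
     (\<forall>b\<in>rows B. \<forall>b'\<in>rows B.
        row_floret B C b \<inter> row_floret B C b' = {} \<or> row_floret B C b = row_floret B C b')"

text \<open>The rows of \<open>B \<Cap> C\<close> are indexed by the florets of \<open>C\<close> themselves.\<close>

definition floret_cap :: "('p, 'c) imatrix \<Rightarrow> ('q, 'c) imatrix \<Rightarrow> ('q set, 'c) imatrix" where
  "floret_cap B C =
     \<lparr>rows = row_floret B C ` rows B, cols = cols C,
      entry = (\<lambda>F j. if \<exists>c\<in>F. j \<in> support C c then 1 else 0)\<rparr>"

definition GRIP :: "nat \<Rightarrow> (nat \<Rightarrow> ('r, 'c) imatrix) \<Rightarrow> bool" where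
  "GRIP k A \<longleftrightarrow>
     (\<forall>l\<in>{1..k - 1}.
        well_connected 2 (stack2 (big_cup A l) (A (l + 1))) \<and>
        floret_condition (big_cup A l) (A (l + 1)) \<and>
        (\<forall>F\<in>rows (floret_cap (big_cup A l) (A (l + 1))).
           row (floret_cap (big_cup A l) (A (l + 1))) F \<in> rowspan (stack A l)))"

section \<open>Staged trees\<close>

text \<open>A finite rooted tree directed away from its root: each vertex is reached from the root
  by exactly one walk.\<close>

locale rooted_tree = pair_fin_digraph G for G :: "'v pair_pre_digraph" +
  fixes r :: 'v
  assumes root_in_verts: "r \<in> pverts G"
    and unique_walk: "\<And>v. v \<in> pverts G \<Longrightarrow> \<exists>!p. awalk r p v"
begin

definition leaf :: "'v \<Rightarrow> bool" where
  "leaf v \<longleftrightarrow> v \<in> pverts G \<and> out_arcs G v = {}"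

definition children :: "'v \<Rightarrow> 'v set" where
  "children v = {w. (v, w) \<in> parcs G}"

definition level :: "'v \<Rightarrow> nat" where
  "level v = length (THE p. awalk r p v)"

definition leaf_paths :: "'v \<Rightarrow> ('v \<times> 'v) awalk set" where
  "leaf_paths v = {p. \<exists>w. leaf w \<and> awalk v p w}"

definition tree_level :: nat where
  "tree_level = (THE k. \<forall>v. leaf v \<longrightarrow> level v = k)"

end

locale labelled_tree = rooted_tree G r for G :: "'v pair_pre_digraph" and r +
  fixes \<theta> :: "'v \<times> 'v \<Rightarrow> 's" and S :: "'s set"
  assumes arcs_nonempty: "parcs G \<noteq> {}"
    and labels_onto: "\<theta> ` parcs G = S"
begin

definition floret :: "'v \<Rightarrow> 's set" where
  "floret v = \<theta> ` out_arcs G v"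

end

locale staged_tree = labelled_tree G r \<theta> S
  for G :: "'v pair_pre_digraph" and r and \<theta> :: "'v \<times> 'v \<Rightarrow> 's" and S +
  assumes inj_labels: "\<And>v. v \<in> pverts G \<Longrightarrow> inj_on \<theta> (out_arcs G v)"
    and florets_equal_or_disjoint: "\<And>v w. v \<in> pverts G \<Longrightarrow> w \<in> pverts G \<Longrightarrow>
      floret v = floret w \<or> floret v \<inter> floret w = {}"
begin

definition stratified :: bool where
  "stratified \<longleftrightarrow>
     (\<forall>v w. leaf v \<longrightarrow> leaf w \<longrightarrow> level v = level w) \<and>
     (\<forall>v\<in>pverts G. \<forall>w\<in>pverts G. floret v = floret w \<longrightarrow> level v = level w)"

text \<open>
  Polynomials in the labels are finitely supported maps from monomials (finitely supported
  exponent vectors) to coefficients, with the convolution product of \<open>Poly_Mapping\<close>.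
\<close>

definition label_var :: "'s \<Rightarrow> ('s \<Rightarrow>\<^sub>0 nat) \<Rightarrow>\<^sub>0 real" where
  "label_var s = Poly_Mapping.single (Poly_Mapping.single s 1) 1"

definition t_poly :: "'v \<Rightarrow> ('s \<Rightarrow>\<^sub>0 nat) \<Rightarrow>\<^sub>0 real" where
  "t_poly v = (\<Sum>p\<in>leaf_paths v. \<Prod>e\<leftarrow>p. label_var (\<theta> e))"

definition balanced :: bool where
  "balanced \<longleftrightarrow>
     (\<forall>v\<in>pverts G. \<forall>w\<in>pverts G. floret v = floret w \<longrightarrow>
        (\<forall>v'\<in>children v. \<forall>v''\<in>children v. \<forall>w'\<in>children w. \<forall>w''\<in>children w.
           v' \<noteq> v'' \<longrightarrow> w' \<noteq> w'' \<longrightarrow>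
           \<theta> (v, v') = \<theta> (w, w') \<longrightarrow> \<theta> (v, v'') = \<theta> (w, w'') \<longrightarrow>
           t_poly v' * t_poly w'' = t_poly w' * t_poly v''))"

definition tree_matrix :: "('s, ('v \<times> 'v) awalk) imatrix" where
  "tree_matrix =
     \<lparr>rows = S, cols = leaf_paths r, entry = (\<lambda>s p. if s \<in> \<theta> ` set p then 1 else 0)\<rparr>"

definition tree_partition :: "nat \<Rightarrow> ('s, ('v \<times> 'v) awalk) imatrix" where
  "tree_partition l =
     tree_matrix\<lparr>rows := {\<theta> (v, w) | v w. (v, w) \<in> parcs G \<and> level v = l - 1 \<and> level w = l}\<rparr>"

text \<open>
  For a stratified tree, the matrices \<open>tree_partition l\<close> with \<open>1 \<le> l \<le> tree_level\<close> are the
  partitions of a multipartition matrix, and every row of \<open>tree_matrix\<close> lies in exactly one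
  of them.
\<close>

lemma level_eq: "awalk r p v \<Longrightarrow> level v = length p"
  unfolding level_def using the1_equality[OF unique_walk] awalk_last_in_verts by blast

lemma finite_leaf_paths: "finite (leaf_paths r)"
proof (rule finite_subset)
  show "leaf_paths r \<subseteq> (\<lambda>w. THE p. awalk r p w) ` pverts G"
  proof
    fix p assume "p \<in> leaf_paths r"
    then obtain w where w: "leaf w" "awalk r p w" by (auto simp: leaf_paths_def)
    then have "w \<in> pverts G" by (simp add: leaf_def)
    then show "p \<in> (\<lambda>w. THE p. awalk r p w) ` pverts G"
      using the1_equality[OF unique_walk w(2)] by (intro image_eqI[of _ _ w]) auto
  qed
qed (simp add: pair_finite_verts)

lemma nth_levels:
  assumes "awalk r p w" "n < length p"
  shows "p ! n \<in> parcs G" "level (fst (p ! n)) = n" "level (snd (p ! n)) = Suc n"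
proof -
  have "p = take n p @ (p ! n) # drop (Suc n) p"
    using assms(2) by (simp add: id_take_nth_drop)
  then have *: "awalk r (take n p @ (p ! n) # drop (Suc n) p) w"
    using assms(1) by simp
  then show a: "p ! n \<in> parcs G" by (auto simp: awalk_def)
  from * have b: "awalk r (take n p) (fst (p ! n))"
    by (auto simp: awalk_append_iff awalk_Cons_iff)
  then show "level (fst (p ! n)) = n" using level_eq assms(2) by fastforce
  have "awalk r (take n p @ [p ! n]) (snd (p ! n))"
    using a b by (auto intro!: awalk_appendI arc_implies_awalk simp: awalk_Cons_iff awalk_Nil_iff
        dest: arc_snd_in_verts arc_fst_in_verts)
  from level_eq[OF this] show "level (snd (p ! n)) = Suc n" using assms(2) by simp
qed

lemma level_arc: "(v, w) \<in> parcs G \<Longrightarrow> level w = Suc (level v)"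
proof -
  assume vw: "(v, w) \<in> parcs G"
  then obtain p where "awalk r p v" using unique_walk in_arcsD1 by blast
  moreover from this vw have "awalk r (p @ [(v, w)]) w"
    by (auto intro!: awalk_appendI simp: awalk_Cons_iff awalk_Nil_iff dest: in_arcsD1 in_arcsD2)
  ultimately show ?thesis using level_eq[of p v] level_eq[of "p @ [(v, w)]" w] by simp
qed

lemma extend_to_leaf:
  assumes "w \<in> pverts G"
  shows "\<exists>q u. leaf u \<and> awalk w q u"
proof -
  let ?U = "{u. \<exists>q. awalk w q u}"
  have "?U \<subseteq> pverts G" by auto
  then have "finite ?U" using pair_finite_verts finite_subset by blast
  moreover have "w \<in> ?U" using assms by (auto simp: awalk_Nil_iff intro: exI[of _ "[]"])
  ultimately have "finite (level ` ?U)" "level ` ?U \<noteq> {}" by auto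
  note Max = Max_in[OF this] Max_ge[OF this(1)]
  from Max(1) obtain u where "u \<in> ?U" "Max (level ` ?U) = level u" by (rule imageE)
  with Max(2) have u: "u \<in> ?U" "\<And>x. x \<in> ?U \<Longrightarrow> level x \<le> level u"
    by simp_all
  then obtain q where q: "awalk w q u" by blast
  have "out_arcs G u = {}"
  proof (rule ccontr)
    assume "out_arcs G u \<noteq> {}"
    then obtain x where x: "(u, x) \<in> parcs G" by auto
    then have "awalk w (q @ [(u, x)]) x" using q
      by (auto intro!: awalk_appendI simp: awalk_Cons_iff awalk_Nil_iff dest: in_arcsD1 in_arcsD2)
    then have "level x \<le> level u" using u(2) by blast
    then show False using level_arc[OF x] by simp
  qed
  moreover have "u \<in> pverts G" using q by auto
  ultimately show ?thesis using q by (auto simp: leaf_def)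
qed

lemma tree_level_eq:
  assumes stratified "leaf v"
  shows "level v = tree_level"
proof -
  have "tree_level = level v" unfolding tree_level_def
    using assms unfolding stratified_def by (intro the_equality) blast+
  then show ?thesis by simp
qed

lemma leaf_path_through:
  assumes "(v, w) \<in> parcs G"
  shows "\<exists>p\<in>leaf_paths r. (v, w) \<in> set p"
proof -
  obtain p where p: "awalk r p v" using unique_walk in_arcsD1 assms by blast
  obtain q u where q: "leaf u" "awalk w q u" using extend_to_leaf in_arcsD2 assms by blast
  have "awalk r (p @ (v, w) # q) u"
    using q assms by (intro awalk_appendI[OF p]) (simp add: awalk_Cons_iff in_arcsD1)
  then have "p @ (v, w) # q \<in> leaf_paths r" using q(1) by (auto simp: leaf_paths_def)
  then show ?thesis by (rule bexI[rotated]) simp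
qed

lemma label_level:
  assumes stratified "(v, w) \<in> parcs G" "(v', w') \<in> parcs G" "\<theta> (v, w) = \<theta> (v', w')"
  shows "level v = level v'"
proof -
  have "\<theta> (v, w) \<in> floret v" "\<theta> (v', w') \<in> floret v'"
    using assms(2,3) imageI[of "(v, w)" "out_arcs G v" \<theta>]
      imageI[of "(v', w')" "out_arcs G v'" \<theta>] by (simp_all add: floret_def)
  then have "floret v \<inter> floret v' \<noteq> {}" using assms(4) by auto
  then have "floret v = floret v'"
    using florets_equal_or_disjoint[of v v'] in_arcsD1[OF assms(2)] in_arcsD1[OF assms(3)]
    by simp
  then show ?thesis using assms(1) in_arcsD1[OF assms(2)] in_arcsD1[OF assms(3)]
    unfolding stratified_def by blast
qed

lemma tree_partition_multipartition:
  assumes stratified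
  shows "multipartition_matrix tree_level tree_partition"
proof -
  have "partition_matrix (tree_partition l)" if l: "l \<in> {1..tree_level}" for l
  proof -
    let ?R = "rows (tree_partition l)"
    have R: "?R = {\<theta> (v, w) | v w. (v, w) \<in> parcs G \<and> level v = l - 1 \<and> level w = l}"
      by (simp add: tree_partition_def)
    have "?R \<subseteq> \<theta> ` parcs G" by (auto simp: R)
    then have fin: "finite ?R" using pair_finite_arcs finite_surj by blast
    have ex1: "\<exists>!i. i \<in> ?R \<and> i \<in> \<theta> ` set p" if p: "p \<in> leaf_paths r" for p
    proof -
      obtain w where w: "leaf w" "awalk r p w" using p by (auto simp: leaf_paths_def)
      have len: "length p = tree_level" using level_eq[OF w(2)] tree_level_eq[OF assms w(1)] by simp
      then have l1: "l - 1 < length p" "Suc (l - 1) = l" using l by auto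
      note n = nth_levels[OF w(2) l1(1)]
      show ?thesis
      proof (rule ex1I[of _ "\<theta> (p ! (l - 1))"])
        show "\<theta> (p ! (l - 1)) \<in> ?R \<and> \<theta> (p ! (l - 1)) \<in> \<theta> ` set p"
        proof
          show "\<theta> (p ! (l - 1)) \<in> ?R"
            unfolding R using n l1(2)
            by (intro CollectI exI[of _ "fst (p ! (l - 1))"] exI[of _ "snd (p ! (l - 1))"]) simp
          show "\<theta> (p ! (l - 1)) \<in> \<theta> ` set p" using l1(1) by (intro imageI nth_mem)
        qed
      next
        fix i assume i: "i \<in> ?R \<and> i \<in> \<theta> ` set p"
        then obtain n where n: "n < length p" "i = \<theta> (p ! n)"
          by (auto simp: in_set_conv_nth)
        obtain v x where vx: "(v, x) \<in> parcs G" "level v = l - 1" "i = \<theta> (v, x)"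
          using i by (auto simp: R)
        have "level v = level (fst (p ! n))"
          using label_level[OF assms vx(1), of "fst (p ! n)" "snd (p ! n)"] vx n
            nth_levels[OF w(2) n(1)] by simp
        then show "i = \<theta> (p ! (l - 1))" using n vx nth_levels[OF w(2) n(1)] by simp
      qed
    qed
    have "\<exists>j\<in>leaf_paths r. i \<in> \<theta> ` set j" if i: "i \<in> ?R" for i
    proof -
      obtain v w where "(v, w) \<in> parcs G" "i = \<theta> (v, w)" using i by (auto simp: R)
      with leaf_path_through[OF this(1)] show ?thesis by blast
    qed
    moreover have "cols (tree_partition l) = leaf_paths r"
      "\<And>i j. entry (tree_partition l) i j \<in> {0, 1}"
      "\<And>i j. entry (tree_partition l) i j = 1 \<longleftrightarrow> i \<in> \<theta> ` set j"
      "\<And>i j. entry (tree_partition l) i j \<noteq> 0 \<longleftrightarrow> i \<in> \<theta> ` set j"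
      by (simp_all add: tree_partition_def tree_matrix_def)
    ultimately show ?thesis
      unfolding partition_matrix_def using fin ex1 finite_leaf_paths by simp
  qed
  moreover have "cols (tree_partition l) = cols (tree_partition 1)" for l
    by (simp add: tree_partition_def)
  ultimately show ?thesis unfolding multipartition_matrix_def by blast
qed

lemma tree_partition_splits_rows:
  assumes stratified "s \<in> rows tree_matrix"
  shows "\<exists>!l. l \<in> {1..tree_level} \<and> s \<in> rows (tree_partition l)"
proof -
  obtain v w where vw: "(v, w) \<in> parcs G" "s = \<theta> (v, w)"
    using assms(2) labels_onto by (auto simp: tree_matrix_def)
  obtain p where p: "p \<in> leaf_paths r" "(v, w) \<in> set p" using leaf_path_through vw by blast
  obtain u where u: "leaf u" "awalk r p u" using p by (auto simp: leaf_paths_def)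
  obtain n where n: "n < length p" "p ! n = (v, w)" using p by (auto simp: in_set_conv_nth)
  have len: "length p = tree_level" using level_eq[OF u(2)] tree_level_eq[OF assms(1) u(1)] by simp
  have lv: "level v = n" "level w = Suc n" using nth_levels[OF u(2) n(1)] n by auto
  show ?thesis
  proof (rule ex1I[of _ "Suc n"])
    show "Suc n \<in> {1..tree_level} \<and> s \<in> rows (tree_partition (Suc n))"
      using vw lv n len by (auto simp: tree_partition_def)
  next
    fix l assume l: "l \<in> {1..tree_level} \<and> s \<in> rows (tree_partition l)"
    then obtain v' w' where "(v', w') \<in> parcs G" "s = \<theta> (v', w')" "level v' = l - 1"
      by (auto simp: tree_partition_def)
    then have "n = l - 1" using label_level[OF assms(1) vw(1)] vw(2) lv(1) by simp
    then show "l = Suc n" using l by simp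
  qed
qed

end

end

theory Submission
  imports Defs
begin

text \<open>
  Evaluate the polynomials \<open>t_poly v\<close> at positive reals.  Balance says that if \<open>v\<close> and \<open>w\<close> have the
  same floret, then the ratio between the value at a child and the value at its parent depends only
  on the label of the connecting edge.  The columns of \<open>A\<^sup>1\<^sup>,\<^sup>\<dots>\<^sup>,\<^sup>l\<close>
  distinguish exactly the vertices of level \<open>l\<close>.  With all labels equal to 1 the values count leaf
  paths, that is, repeated columns, which gives well-connectedness; the floret condition is the
  disjointness of florets.  For the rowspan condition and a floret \<open>F\<close> of level-\<open>l\<close> vertices, put the
  labels in \<open>F\<close> equal to 2 and the others to 1.  Relative to the count of leaf paths, the value at a
  vertex of level \<open>l\<close> is then 2 if its floret is \<open>F\<close> and 1 otherwise.  Its binary logarithm is the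
  wanted indicator, and telescoping along the path from the root writes it as a sum of terms that
  depend only on the first \<open>l\<close> labels.
\<close>

section \<open>Evaluation of polynomials\<close>

definition eval_monom :: "('s \<Rightarrow> real) \<Rightarrow> ('s \<Rightarrow>\<^sub>0 nat) \<Rightarrow> real" where
  "eval_monom x m = (\<Prod>s\<in>Poly_Mapping.keys m. x s ^ Poly_Mapping.lookup m s)"

definition eval_poly :: "('s \<Rightarrow> real) \<Rightarrow> (('s \<Rightarrow>\<^sub>0 nat) \<Rightarrow>\<^sub>0 real) \<Rightarrow> real" where
  "eval_poly x P = (\<Sum>m\<in>Poly_Mapping.keys P. Poly_Mapping.lookup P m * eval_monom x m)"

text \<open>A variable outside the support contributes \<open>x s ^ 0 = 1\<close>. The larger index
  set lets two monomials and their product be compared over the same variables.\<close>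

lemma eval_monom_superset:
  assumes "finite A" "Poly_Mapping.keys m \<subseteq> A"
  shows "eval_monom x m = (\<Prod>s\<in>A. x s ^ Poly_Mapping.lookup m s)"
  unfolding eval_monom_def using assms
  by (intro prod.mono_neutral_left) (auto simp: in_keys_iff)

lemma eval_monom_add: "eval_monom x (m + n) = eval_monom x m * eval_monom x n"
proof -
  let ?A = "Poly_Mapping.keys m \<union> Poly_Mapping.keys n"
  have "eval_monom x (m + n) = (\<Prod>s\<in>?A. x s ^ Poly_Mapping.lookup (m + n) s)"
    by (intro eval_monom_superset keys_add) simp
  also have "\<dots> = (\<Prod>s\<in>?A. x s ^ Poly_Mapping.lookup m s) * (\<Prod>s\<in>?A. x s ^ Poly_Mapping.lookup n s)"
    by (simp add: lookup_add power_add prod.distrib)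
  also have "\<dots> = eval_monom x m * eval_monom x n"
    by (simp add: eval_monom_superset[of ?A])
  finally show ?thesis .
qed

lemma eval_poly_single [simp]: "eval_poly x (Poly_Mapping.single m a) = a * eval_monom x m"
  by (simp add: eval_poly_def)

lemma eval_poly_add: "eval_poly x (P + Q) = eval_poly x P + eval_poly x Q"
  unfolding eval_poly_def
  by (rule setsum_keys_plus_distrib) (simp_all add: algebra_simps)

lemma eval_poly_zero [simp]: "eval_poly x 0 = 0"
  by (simp add: eval_poly_def)

lemma eval_poly_sum: "eval_poly x (\<Sum>i\<in>I. P i) = (\<Sum>i\<in>I. eval_poly x (P i))"
  by (induction I rule: infinite_finite_induct) (simp_all add: eval_poly_add)

lemma eval_poly_one [simp]: "eval_poly x 1 = 1"
  by (simp add: eval_monom_def flip: single_one)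

lemma poly_mapping_eq_sum_single:
  "P = (\<Sum>m\<in>Poly_Mapping.keys P. Poly_Mapping.single m (Poly_Mapping.lookup P m))"
  by (rule poly_mapping_eqI) (simp add: lookup_sum lookup_single when_def in_keys_iff)

text \<open>Both factors are split into single terms, for which \<open>eval_monom_add\<close>
  suffices. Multiplicativity is what turns the polynomial balance equations into equations between
  real numbers.\<close>

lemma eval_poly_mult: "eval_poly x (P * Q) = eval_poly x P * eval_poly x Q"
proof -
  let ?c = Poly_Mapping.lookup and ?K = Poly_Mapping.keys
  have "P * Q = (\<Sum>m\<in>?K P. Poly_Mapping.single m (?c P m)) * (\<Sum>n\<in>?K Q. Poly_Mapping.single n (?c Q n))"
    using poly_mapping_eq_sum_single[of P] poly_mapping_eq_sum_single[of Q] by simp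
  also have "\<dots> = (\<Sum>m\<in>?K P. \<Sum>n\<in>?K Q. Poly_Mapping.single (m + n) (?c P m * ?c Q n))"
    by (simp add: sum_product mult_single)
  also have "eval_poly x \<dots> = eval_poly x P * eval_poly x Q"
    by (simp add: eval_poly_sum eval_monom_add eval_poly_def[of x P] eval_poly_def[of x Q]
        sum_product mult_ac)
  finally show ?thesis .
qed

section \<open>Columns of stacked matrices\<close>

lemma column_eq_iff:
  "column M j = column M j' \<longleftrightarrow> (\<forall>i\<in>rows M. entry M i j = entry M i j')"
  by (auto simp: column_def fun_eq_iff restrict_def)

lemma column_stack_eq_iff:
  "column (stack A l) j = column (stack A l) j' \<longleftrightarrow>
     (\<forall>n\<in>{1..l}. column (A n) j = column (A n) j')"
  by (auto simp: column_eq_iff stack_def)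

lemma cols_stack [simp]: "cols (stack A l) = cols (A 1)"
  by (simp add: stack_def)

lemma column_map_rows_eq_iff:
  assumes "inj_on f (rows M)"
  shows "column (map_rows f M) j = column (map_rows f M) j' \<longleftrightarrow> column M j = column M j'"
  using assms by (simp add: column_eq_iff map_rows_def)

lemma column_stack2_eq_iff:
  "column (stack2 B C l) j = column (stack2 B C l) j' \<longleftrightarrow>
     (if l = 1 then column B j = column B j' else column C j = column C j')"
  by (simp add: stack2_def column_map_rows_eq_iff)

text \<open>These are the denominator and the numerator of the well-connectedness quotient of two
  stacked matrices.\<close>

lemma
  shows col_mult_stack2_1:
      "col_mult (stack2 B C) 1 j = card {j' \<in> cols B. column B j' = column B j}"
    and col_mult_stack2_2:
      "col_mult (stack2 B C) 2 j =
        card {j' \<in> cols B. column B j' = column B j \<and> column C j' = column C j}"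
proof -
  have "cols (stack (stack2 B C) l) = cols B" for l
    by (simp add: stack_def stack2_def map_rows_def)
  moreover have "{1..2::nat} = {1, 2}" by auto
  ultimately show
    "col_mult (stack2 B C) 1 j = card {j' \<in> cols B. column B j' = column B j}"
    "col_mult (stack2 B C) 2 j =
        card {j' \<in> cols B. column B j' = column B j \<and> column C j' = column C j}"
    by (simp_all add: col_mult_def column_stack_eq_iff column_stack2_eq_iff)
qed

lemma support_map_rows:
  assumes "inj_on f (rows M)" "i \<in> rows M"
  shows "support (map_rows f M) (f i) = support M i"
  using assms by (simp add: support_def map_rows_def)

text \<open>Columns of \<open>big_cup A l\<close> are standard basis vectors. The row named by the
  stacked column of \<open>j\<close> separates \<open>j\<close> from every \<open>j'\<close> with
  another stacked column, and \<open>j \<in> cols (A 1)\<close> ensures that this row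
  exists.\<close>

lemma column_big_cup_eq_iff:
  assumes "j \<in> cols (A 1)" "j' \<in> cols (A 1)"
  shows "column (big_cup A l) j = column (big_cup A l) j' \<longleftrightarrow>
    column (stack A l) j = column (stack A l) j'"
  using assms unfolding column_eq_iff[of "big_cup A l"] by (auto simp: big_cup_def)

lemma support_big_cup:
  "support (big_cup A l) (column (stack A l) j) =
     {j' \<in> cols (A 1). column (stack A l) j' = column (stack A l) j}"
  by (auto simp: support_def big_cup_def)

section \<open>Path sums\<close>

context staged_tree
begin

text \<open>This is the value of \<open>t_poly v\<close> at the point \<open>x\<close>, written as a
  sum of reals so that positivity and the recursion over children need no polynomials.\<close>

definition path_sum :: "('s \<Rightarrow> real) \<Rightarrow> 'v \<Rightarrow> real" where
  "path_sum x v = (\<Sum>p\<in>leaf_paths v. \<Prod>e\<leftarrow>p. x (\<theta> e))"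

lemma eval_t_poly: "eval_poly x (t_poly v) = path_sum x v"
proof -
  have "eval_poly x (\<Prod>e\<leftarrow>p. label_var (\<theta> e)) = (\<Prod>e\<leftarrow>p. x (\<theta> e))" for p :: "('v \<times> 'v) list"
    by (induction p) (simp_all add: eval_poly_mult label_var_def eval_monom_def)
  then show ?thesis by (simp add: t_poly_def path_sum_def eval_poly_sum)
qed

text \<open>Cutting a root-to-leaf path after the prefix \<open>p\<close> leaves a path from
  \<open>v\<close> to a leaf. Counting columns with a common prefix thus becomes counting leaf paths
  from one vertex.\<close>

lemma leaf_paths_extending:
  assumes "awalk r p v"
  shows "{q \<in> leaf_paths r. take (length p) q = p} = (@) p ` leaf_paths v"
proof safe
  fix q assume q: "q \<in> leaf_paths r" "take (length p) q = p"
  then obtain w where w: "leaf w" "awalk r q w" by (auto simp: leaf_paths_def)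
  have "q = p @ drop (length p) q" using q(2) by (metis append_take_drop_id)
  moreover have "awalk v (drop (length p) q) w"
    using w(2) assms awalk_append_iff[of r p "drop (length p) q" w] calculation by auto
  ultimately show "q \<in> (@) p ` leaf_paths v"
    using w(1) by (auto simp: leaf_paths_def)
next
  fix q assume "q \<in> leaf_paths v"
  then show "p @ q \<in> leaf_paths r"
    using awalk_appendI[OF assms] by (auto simp: leaf_paths_def)
qed simp

lemma card_leaf_paths_extending:
  assumes "awalk r p v"
  shows "card {q \<in> leaf_paths r. take (length p) q = p} = card (leaf_paths v)"
  unfolding leaf_paths_extending[OF assms] by (intro card_image) (simp add: inj_on_def)

text \<open>Prepending the walk from the root to \<open>v\<close> embeds these paths into the finite
  set \<open>leaf_paths r\<close>.\<close>

lemma finite_leaf_paths_from: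
  assumes "v \<in> pverts G"
  shows "finite (leaf_paths v)"
proof -
  obtain p where p: "awalk r p v" using unique_walk[OF assms] by blast
  have "finite ((@) p ` leaf_paths v)"
    unfolding leaf_paths_extending[OF p, symmetric] using finite_leaf_paths by simp
  then show ?thesis by (rule finite_imageD) (simp add: inj_on_def)
qed

lemma path_labels_in_S: "awalk v p w \<Longrightarrow> e \<in> set p \<Longrightarrow> \<theta> e \<in> S"
  using labels_onto by (auto simp: awalk_def)

text \<open>Every vertex has a walk to some leaf, so the sum is nonempty, and all its terms are
  positive. This later permits division and logarithms.\<close>

lemma path_sum_pos:
  assumes "v \<in> pverts G" "\<And>s. s \<in> S \<Longrightarrow> x s > 0"
  shows "path_sum x v > 0"
  unfolding path_sum_def
proof (rule sum_pos)
  show "finite (leaf_paths v)" using assms(1) by (rule finite_leaf_paths_from)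
  show "leaf_paths v \<noteq> {}" using extend_to_leaf[OF assms(1)] by (auto simp: leaf_paths_def)
  fix p assume "p \<in> leaf_paths v"
  then have "\<forall>e\<in>set p. x (\<theta> e) > 0"
    using assms(2) path_labels_in_S by (auto simp: leaf_paths_def)
  then show "(\<Prod>e\<leftarrow>p. x (\<theta> e)) > 0" by (induction p) auto
qed

lemma path_sum_one: "path_sum (\<lambda>_. 1) v = real (card (leaf_paths v))"
proof -
  have "(\<Prod>e\<leftarrow>p. 1 :: real) = 1" for p :: "('v \<times> 'v) list" by (induction p) auto
  then show ?thesis by (simp add: path_sum_def)
qed

section \<open>Recursion over children and the balance equation\<close>

lemma leaf_paths_step:
  assumes "v \<in> pverts G" "\<not> leaf v"
  shows "leaf_paths v = (\<Union>w\<in>children v. (#) (v, w) ` leaf_paths w)"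
proof safe
  fix p assume "p \<in> leaf_paths v"
  then obtain u where u: "leaf u" "awalk v p u" by (auto simp: leaf_paths_def)
  with assms obtain e q where p: "p = e # q" by (cases p) (auto simp: awalk_Nil_iff)
  with u have "fst e = v" "e \<in> parcs G" "awalk (snd e) q u" by (auto simp: awalk_Cons_iff)
  with u p show "p \<in> (\<Union>w\<in>children v. (#) (v, w) ` leaf_paths w)"
    by (cases e) (auto simp: leaf_paths_def children_def)
qed (auto simp: leaf_paths_def children_def awalk_Cons_iff)

lemma children_in_verts: "w \<in> children v \<Longrightarrow> w \<in> pverts G"
  unfolding children_def using in_arcsD2 by blast

lemma finite_children: "finite (children v)"
  by (rule finite_subset[OF _ pair_finite_verts]) (auto intro: children_in_verts)

text \<open>The leaf paths are grouped by their first arc, whose factor is taken out of each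
  group.\<close>

lemma path_sum_step:
  assumes "v \<in> pverts G" "\<not> leaf v"
  shows "path_sum x v = (\<Sum>w\<in>children v. x (\<theta> (v, w)) * path_sum x w)"
proof -
  have "path_sum x v = (\<Sum>w\<in>children v. \<Sum>p\<in>(#) (v, w) ` leaf_paths w. \<Prod>e\<leftarrow>p. x (\<theta> e))"
    unfolding path_sum_def leaf_paths_step[OF assms]
    by (rule sum.UNION_disjoint)
      (auto simp: finite_children children_in_verts finite_leaf_paths_from)
  also have "\<dots> = (\<Sum>w\<in>children v. x (\<theta> (v, w)) * path_sum x w)"
    by (intro sum.cong refl) (simp add: sum.reindex inj_on_def path_sum_def sum_distrib_left)
  finally show ?thesis .
qed

lemma leaf_iff_floret: "v \<in> pverts G \<Longrightarrow> leaf v \<longleftrightarrow> floret v = {}"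
  by (simp add: leaf_def floret_def)

lemma floret_eq_image_children: "floret v = (\<lambda>w. \<theta> (v, w)) ` children v"
  by (auto simp: floret_def children_def image_iff)

lemma arc_label_inj:
  assumes "e \<in> parcs G" "e' \<in> parcs G" "fst e = fst e'" "\<theta> e = \<theta> e'"
  shows "e = e'"
proof -
  have "e \<in> out_arcs G (fst e)" "e' \<in> out_arcs G (fst e)" "fst e \<in> pverts G"
    using assms(1-3) in_arcsD1[of "fst e" "snd e"] by simp_all
  then show ?thesis using inj_onD[OF inj_labels assms(4)] by blast
qed

lemma children_label_inj:
  assumes "w \<in> children v" "w' \<in> children v" "\<theta> (v, w) = \<theta> (v, w')"
  shows "w = w'"
  using arc_label_inj[of "(v, w)" "(v, w')"] assms by (simp add: children_def)

text \<open>This is the sum of the balance equation over all children \<open>w''\<close> of \<open>w\<close>.\<close>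

lemma child_ratio:
  assumes balanced
    and v: "v \<in> pverts G" "v' \<in> children v" and w: "w \<in> pverts G" "w' \<in> children w"
    and F: "floret v = floret w" and label: "\<theta> (v, v') = \<theta> (w, w')"
  shows "path_sum x v' * path_sum x w = path_sum x w' * path_sum x v"
proof -
  \<comment> \<open>\<open>g\<close> sends a child of \<open>v\<close> to the child of
    \<open>w\<close> that carries the same label. It exists because the florets agree and is unique
    because labels are injective on outgoing arcs.\<close>
  define g where "g y = (THE y'. y' \<in> children w \<and> \<theta> (w, y') = \<theta> (v, y))" for y
  have g: "g y \<in> children w" "\<theta> (w, g y) = \<theta> (v, y)" if "y \<in> children v" for y
  proof -
    have "\<theta> (v, y) \<in> floret w" using that F floret_eq_image_children[of v] by auto
    then obtain y' where y': "y' \<in> children w" "\<theta> (w, y') = \<theta> (v, y)"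
      by (auto simp: floret_eq_image_children)
    have "g y = y'" unfolding g_def using y' children_label_inj[of _ w]
      by (intro the_equality) auto
    then show "g y \<in> children w" "\<theta> (w, g y) = \<theta> (v, y)" using y' by auto
  qed
  have bij: "bij_betw g (children v) (children w)"
  proof (rule bij_betwI')
    fix y z assume yz: "y \<in> children v" "z \<in> children v"
    then show "g y = g z \<longleftrightarrow> y = z" using g children_label_inj by metis
  next
    fix y' assume y': "y' \<in> children w"
    then have "\<theta> (w, y') \<in> floret v" using F floret_eq_image_children[of w] by auto
    then obtain y where y: "y \<in> children v" "\<theta> (v, y) = \<theta> (w, y')"
      by (auto simp: floret_eq_image_children)
    then show "\<exists>y\<in>children v. y' = g y" using g[of y] y' children_label_inj[of y' w "g y"] by metis
  qed (use g in auto)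
  have gv': "g v' = w'" using g[OF v(2)] w label children_label_inj by metis
  have eq: "path_sum x v' * path_sum x (g y) = path_sum x w' * path_sum x y"
    if y: "y \<in> children v" for y
  \<comment> \<open>Balance speaks only of distinct children. For \<open>y = v'\<close> the two
    sides coincide since \<open>g v' = w'\<close>.\<close>
  proof (cases "y = v'")
    case False
    then have "g y \<noteq> w'" using g[OF y] label children_label_inj[OF y v(2)] by auto
    then have "t_poly v' * t_poly (g y) = t_poly w' * t_poly y"
      using False g(2)[OF y] label
      by (intro assms(1)[unfolded balanced_def, rule_format, OF v(1) w(1) F v(2) y w(2) g(1)[OF y]])
        simp_all
    then show ?thesis by (metis eval_poly_mult eval_t_poly)
  qed (simp add: gv')
  have nl: "\<not> leaf v" "\<not> leaf w"
    using v w by (auto simp: leaf_iff_floret floret_eq_image_children)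
  \<comment> \<open>Reindexing along \<open>g\<close> expresses both parent values as sums over the
    children of \<open>v\<close>, so that \<open>eq\<close> applies term by term.\<close>
  have "path_sum x w = (\<Sum>y\<in>children v. x (\<theta> (w, g y)) * path_sum x (g y))"
    unfolding path_sum_step[OF w(1) nl(2)]
    by (rule sum.reindex_bij_betw[OF bij, symmetric])
  then have "path_sum x v' * path_sum x w =
      (\<Sum>y\<in>children v. x (\<theta> (w, g y)) * (path_sum x v' * path_sum x (g y)))"
    by (simp add: sum_distrib_left mult_ac)
  also have "\<dots> = (\<Sum>y\<in>children v. x (\<theta> (v, y)) * (path_sum x w' * path_sum x y))"
    using g eq by simp
  also have "\<dots> = path_sum x w' * path_sum x v"
    unfolding path_sum_step[OF v(1) nl(1)] by (simp add: sum_distrib_left mult_ac)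
  finally show ?thesis .
qed

section \<open>Prefixes, levels and florets along walks\<close>

lemma prefix_walk:
  assumes "awalk r p w" "n < length p"
  shows "awalk r (take n p) (fst (p ! n))" "awalk r (take (Suc n) p) (snd (p ! n))"
proof -
  have "p = take n p @ (p ! n) # drop (Suc n) p"
    using assms(2) by (simp add: id_take_nth_drop)
  then have *: "awalk r (take n p @ (p ! n) # drop (Suc n) p) w"
    using assms(1) by simp
  then show a: "awalk r (take n p) (fst (p ! n))"
    by (auto simp: awalk_append_iff awalk_Cons_iff)
  have "p ! n \<in> parcs G" using nth_levels[OF assms] by simp
  then have "awalk (fst (p ! n)) [p ! n] (snd (p ! n))"
    using in_arcsD2[of "fst (p ! n)" "snd (p ! n)"] by (simp add: awalk_Cons_iff awalk_Nil_iff)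
  from awalk_appendI[OF a this] show "awalk r (take (Suc n) p) (snd (p ! n))"
    using assms(2) by (simp add: take_Suc_conv_app_nth)
qed

lemma awalk_end_unique: "awalk u p v \<Longrightarrow> awalk u p w \<Longrightarrow> v = w"
  by (induction p arbitrary: u) (auto simp: awalk_Nil_iff awalk_Cons_iff)

text \<open>Both vertices are the end of the same walk \<open>take (Suc n) p\<close> from the
  root.\<close>

lemma consecutive_arcs:
  assumes "awalk r p w" "Suc n < length p"
  shows "snd (p ! n) = fst (p ! Suc n)"
  using prefix_walk(2)[OF assms(1), of n] prefix_walk(1)[OF assms] assms(2)
  by (auto dest: awalk_end_unique)

lemma first_vertex:
  assumes "awalk r p w" "0 < length p"
  shows "fst (p ! 0) = r"
  using prefix_walk(1)[OF assms] by (simp add: awalk_Nil_iff)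

text \<open>Levels grow by one along each arc. The bound serves to show that the arcs below a child
  start at a level strictly deeper than its parent.\<close>

lemma level_le_along_walk:
  "awalk v p u \<Longrightarrow> e \<in> set p \<Longrightarrow> level v \<le> level (fst e)"
proof (induction p arbitrary: v)
  case (Cons a p)
  then have a: "a \<in> parcs G" "fst a = v" "awalk (snd a) p u" by (auto simp: awalk_Cons_iff)
  then have "level (snd a) = Suc (level v)" using level_arc[of v "snd a"] by (cases a) simp
  then show ?case using Cons.IH[OF a(3)] Cons.prems(2) a(2) by auto
qed simp

lemma in_floret: "e \<in> parcs G \<Longrightarrow> \<theta> e \<in> floret (fst e)"
  by (simp add: floret_def)

text \<open>A shared label rules out disjoint florets, so they are equal.\<close>

lemma floret_of_label:
  assumes "e \<in> parcs G" "v \<in> pverts G" "\<theta> e \<in> floret v"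
  shows "floret (fst e) = floret v"
  using florets_equal_or_disjoint[of "fst e" v] in_floret[of e]
    in_arcsD1[of "fst e" "snd e"] assms by auto

section \<open>The matrix of a stratified staged tree\<close>

context
  assumes strat: stratified
begin

lemma leaf_path_obtain:
  assumes "p \<in> leaf_paths r"
  obtains w where "leaf w" "awalk r p w" "length p = tree_level"
proof -
  obtain w where w: "leaf w" "awalk r p w" using assms by (auto simp: leaf_paths_def)
  then show thesis using that level_eq[OF w(2)] tree_level_eq[OF strat w(1)] by simp
qed

lemma cols_tree_partition [simp]: "cols (tree_partition l) = leaf_paths r"
  by (simp add: tree_partition_def tree_matrix_def)

lemma entry_tree_partition [simp]:
  "entry (tree_partition l) i p = (if i \<in> \<theta> ` set p then 1 else 0)"
  by (simp add: tree_partition_def tree_matrix_def)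

lemma support_tree_partition:
  "support (tree_partition l) i = {p \<in> leaf_paths r. i \<in> \<theta> ` set p}"
  by (auto simp: support_def)

section \<open>Labels, columns and prefixes of root-to-leaf paths\<close>

text \<open>List positions start at 0: the arc \<open>p ! n\<close> goes from level \<open>n\<close>
  to level \<open>Suc n\<close> and therefore belongs to partition \<open>Suc n\<close>.\<close>

lemma nth_label_in_rows:
  assumes "p \<in> leaf_paths r" "n < tree_level"
  shows "\<theta> (p ! n) \<in> rows (tree_partition (Suc n))"
proof -
  obtain w where "awalk r p w" "length p = tree_level" using assms(1) by (rule leaf_path_obtain)
  with assms(2) nth_levels[of p w n] show ?thesis
    by (cases "p ! n") (auto simp: tree_partition_def)
qed

text \<open>A column of a partition matrix has exactly one entry 1, and the label of
  \<open>p ! n\<close> provides it.\<close>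

lemma label_on_path_iff:
  assumes p: "p \<in> leaf_paths r" and n: "n < tree_level" and i: "i \<in> rows (tree_partition (Suc n))"
  shows "i \<in> \<theta> ` set p \<longleftrightarrow> i = \<theta> (p ! n)"
proof -
  have "partition_matrix (tree_partition (Suc n))"
    using tree_partition_multipartition[OF strat] n by (simp add: multipartition_matrix_def)
  then have "\<exists>!i. i \<in> rows (tree_partition (Suc n)) \<and> entry (tree_partition (Suc n)) i p = 1"
    using p unfolding partition_matrix_def cols_tree_partition by blast
  moreover have "entry (tree_partition (Suc n)) i p = 1 \<longleftrightarrow> i \<in> \<theta> ` set p" for i
    by (simp only: entry_tree_partition split: if_split) simp
  ultimately have "\<exists>!i. i \<in> rows (tree_partition (Suc n)) \<and> i \<in> \<theta> ` set p"
    by (simp only:)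
  moreover have "\<theta> (p ! n) \<in> \<theta> ` set p"
    using n p by (auto elim!: leaf_path_obtain)
  ultimately show ?thesis using i nth_label_in_rows[OF p n] by blast
qed

lemma column_tree_partition_eq_iff:
  assumes "p \<in> leaf_paths r" "q \<in> leaf_paths r" "n < tree_level"
  shows "column (tree_partition (Suc n)) p = column (tree_partition (Suc n)) q \<longleftrightarrow>
    \<theta> (p ! n) = \<theta> (q ! n)"
  using assms nth_label_in_rows[OF assms(1,3)]
  by (auto simp: column_eq_iff label_on_path_iff split: if_splits)

text \<open>Equal prefixes end at the same vertex, and there the next label determines the next arc.
  By induction the labels determine the prefix.\<close>

lemma take_eq_iff_labels_eq:
  assumes p: "p \<in> leaf_paths r" and q: "q \<in> leaf_paths r"
  shows "l \<le> tree_level \<Longrightarrow> take l p = take l q \<longleftrightarrow> (\<forall>n<l. \<theta> (p ! n) = \<theta> (q ! n))"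
proof (induction l)
  case (Suc l)
  obtain u w where u: "awalk r p u" "length p = tree_level"
    and w: "awalk r q w" "length q = tree_level"
    using p q by (auto elim!: leaf_path_obtain)
  have l: "l < length p" "l < length q" using Suc.prems u w by auto
  have "p ! l = q ! l" if eq: "take l p = take l q" "\<theta> (p ! l) = \<theta> (q ! l)"
  proof -
    have "fst (p ! l) = fst (q ! l)"
      using prefix_walk(1)[OF u(1) l(1)] prefix_walk(1)[OF w(1) l(2)] eq(1)
      by (simp add: awalk_end_unique)
    then show ?thesis
      using nth_levels(1)[OF u(1) l(1)] nth_levels(1)[OF w(1) l(2)] eq(2)
      by (intro arc_label_inj)
  qed
  moreover have "take (Suc l) p = take (Suc l) q \<longleftrightarrow> take l p = take l q \<and> p ! l = q ! l"
    using l by (simp add: take_Suc_conv_app_nth)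
  moreover have "take l p = take l q \<longleftrightarrow> (\<forall>n<l. \<theta> (p ! n) = \<theta> (q ! n))"
    using Suc by simp
  ultimately show ?case by (auto simp: less_Suc_eq)
qed simp

lemma column_stack_tree_eq_iff:
  assumes p: "p \<in> leaf_paths r" and q: "q \<in> leaf_paths r" and l: "l \<le> tree_level"
  shows "column (stack tree_partition l) p = column (stack tree_partition l) q \<longleftrightarrow>
    take l p = take l q"
proof -
  \<comment> \<open>Partitions are numbered from 1, arcs of a path from 0.\<close>
  have "{1..l} = Suc ` {..<l}" by (simp add: image_Suc_lessThan)
  then show ?thesis
    unfolding column_stack_eq_iff take_eq_iff_labels_eq[OF p q l]
    using column_tree_partition_eq_iff[OF p q] l by auto
qed

text \<open>The prefix of \<open>p\<close> is continued by the chosen arc and then by any walk to a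
  leaf. Hence every label of the floret at this vertex occurs on a path with the same
  prefix.\<close>

lemma leaf_path_branch:
  assumes p: "p \<in> leaf_paths r" and l: "l < tree_level" and w: "(fst (p ! l), w) \<in> parcs G"
  shows "\<exists>q\<in>leaf_paths r. take l q = take l p \<and> q ! l = (fst (p ! l), w)"
proof -
  obtain u where u: "awalk r p u" "length p = tree_level" using p by (rule leaf_path_obtain)
  obtain q z where q: "leaf z" "awalk w q z" using extend_to_leaf in_arcsD2[OF w] by blast
  have "awalk r (take l p @ (fst (p ! l), w) # q) z"
    using prefix_walk(1)[OF u(1)] u l q w by (intro awalk_appendI) (auto simp: awalk_Cons_iff)
  then have "take l p @ (fst (p ! l), w) # q \<in> leaf_paths r" using q(1) by (auto simp: leaf_paths_def)
  then show ?thesis by (rule bexI[rotated]) (use u l in \<open>auto simp: nth_append\<close>)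
qed

text \<open>A row of \<open>big_cup\<close> collects the paths with one prefix of length
  \<open>l\<close>, which all pass through the same vertex of level \<open>l\<close>. Their next
  labels are exactly the floret of that vertex, so matrix florets are tree florets.\<close>

lemma row_floret_tree:
  assumes p: "p \<in> leaf_paths r" and l: "l < tree_level"
  shows "row_floret (big_cup tree_partition l) (tree_partition (Suc l))
    (column (stack tree_partition l) p) = floret (fst (p ! l))"
proof -
  let ?b = "column (stack tree_partition l) p"
  obtain u where u: "awalk r p u" "length p = tree_level" using p by (rule leaf_path_obtain)
  have sup: "support (big_cup tree_partition l) ?b = {q \<in> leaf_paths r. take l q = take l p}"
    using column_stack_tree_eq_iff p l by (auto simp: support_big_cup)
  have "row_floret (big_cup tree_partition l) (tree_partition (Suc l)) ?b =
      {i \<in> rows (tree_partition (Suc l)). \<exists>q\<in>leaf_paths r. take l q = take l p \<and> i \<in> \<theta> ` set q}"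
    unfolding row_floret_def connected_rows_def sup support_tree_partition by auto
  also have "\<dots> = (\<lambda>q. \<theta> (q ! l)) ` {q \<in> leaf_paths r. take l q = take l p}"
    using label_on_path_iff[OF _ l] nth_label_in_rows[OF _ l] by auto
  also have "\<dots> = floret (fst (p ! l))"
  proof (intro equalityI subsetI)
    fix i assume "i \<in> (\<lambda>q. \<theta> (q ! l)) ` {q \<in> leaf_paths r. take l q = take l p}"
    then obtain q where q: "q \<in> leaf_paths r" "take l q = take l p" "i = \<theta> (q ! l)" by auto
    obtain w where w: "awalk r q w" "length q = tree_level" using q(1) by (rule leaf_path_obtain)
    have "fst (q ! l) = fst (p ! l)"
      using prefix_walk(1)[OF u(1), of l] prefix_walk(1)[OF w(1), of l] u w l q(2)
      by (simp add: awalk_end_unique)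
    then show "i \<in> floret (fst (p ! l))"
      using in_floret[of "q ! l"] nth_levels(1)[OF w(1)] w l q(3) by simp
  next
    fix i assume "i \<in> floret (fst (p ! l))"
    then obtain w where w: "(fst (p ! l), w) \<in> parcs G" "i = \<theta> (fst (p ! l), w)"
      by (auto simp: floret_eq_image_children children_def)
    with leaf_path_branch[OF p l w(1)]
    show "i \<in> (\<lambda>q. \<theta> (q ! l)) ` {q \<in> leaf_paths r. take l q = take l p}" by force
  qed
  finally show ?thesis .
qed

lemma nth_vertex:
  assumes "p \<in> leaf_paths r" "l < tree_level"
  shows "fst (p ! l) \<in> pverts G" "snd (p ! l) \<in> children (fst (p ! l))" "level (fst (p ! l)) = l"
    "p ! l \<in> parcs G"
proof -
  obtain u where u: "awalk r p u" "length p = tree_level" using assms(1) by (rule leaf_path_obtain)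
  then have "p ! l \<in> parcs G" "level (fst (p ! l)) = l" using nth_levels[OF u(1)] assms(2) by auto
  then show "fst (p ! l) \<in> pverts G" "snd (p ! l) \<in> children (fst (p ! l))"
    "level (fst (p ! l)) = l" "p ! l \<in> parcs G"
    using in_arcsD1[of "fst (p ! l)" "snd (p ! l)"] by (auto simp: children_def)
qed

section \<open>The floret condition and well-connectedness\<close>

lemma floret_condition_tree:
  assumes "l < tree_level"
  shows "floret_condition (big_cup tree_partition l) (tree_partition (Suc l))"
proof -
  have "rows (big_cup tree_partition l) = column (stack tree_partition l) ` leaf_paths r"
    by (simp add: big_cup_def)
  then show ?thesis
    using florets_equal_or_disjoint[OF nth_vertex(1) nth_vertex(1)] assms
    by (simp add: floret_condition_def row_floret_tree Int_commute disj_commute)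
qed

text \<open>The quotient at a column \<open>p\<close> is the number of leaf paths below
  \<open>snd (p ! l)\<close> divided by the number below \<open>fst (p ! l)\<close>. By
  \<open>child_ratio\<close> with all labels 1 it depends only on the label of
  \<open>p ! l\<close>.\<close>

lemma well_connected_tree:
  assumes bal: balanced and l: "l < tree_level"
  shows "well_connected 2 (stack2 (big_cup tree_partition l) (tree_partition (Suc l)))"
proof -
  let ?B = "big_cup tree_partition l" and ?C = "tree_partition (Suc l)"
  have cols: "cols ?B = leaf_paths r" by (simp add: big_cup_def)
  have B: "column ?B q = column ?B p \<longleftrightarrow> take l q = take l p"
    if "p \<in> leaf_paths r" "q \<in> leaf_paths r" for p q
    using that l by (simp add: column_big_cup_eq_iff column_stack_tree_eq_iff)
  have BC: "column ?B q = column ?B p \<and> column ?C q = column ?C p \<longleftrightarrow> take (Suc l) q = take (Suc l) p"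
    if "p \<in> leaf_paths r" "q \<in> leaf_paths r" for p q
    using that l take_eq_iff_labels_eq[of q p l] take_eq_iff_labels_eq[of q p "Suc l"]
    by (auto simp: B column_tree_partition_eq_iff less_Suc_eq)
  \<comment> \<open>Columns equal to the one of \<open>p\<close> are the leaf paths that share its
    prefix, and these correspond to the leaf paths from the end of the prefix.\<close>
  have mult: "real (col_mult (stack2 ?B ?C) 1 p) = path_sum (\<lambda>_. 1) (fst (p ! l))"
    "real (col_mult (stack2 ?B ?C) 2 p) = path_sum (\<lambda>_. 1) (snd (p ! l))"
    if p: "p \<in> leaf_paths r" for p
  proof -
    obtain u where u: "awalk r p u" "length p = tree_level" using p by (rule leaf_path_obtain)
    have len: "length (take l p) = l" "length (take (Suc l) p) = Suc l" using u l by auto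
    note w = prefix_walk[OF u(1), of l]
    have "{q \<in> cols ?B. column ?B q = column ?B p} = {q \<in> leaf_paths r. take l q = take l p}"
      using B[OF p] cols by auto
    then show "real (col_mult (stack2 ?B ?C) 1 p) = path_sum (\<lambda>_. 1) (fst (p ! l))"
      using card_leaf_paths_extending[OF w(1)] l u len
      by (simp only: col_mult_stack2_1 path_sum_one)
    have "{q \<in> cols ?B. column ?B q = column ?B p \<and> column ?C q = column ?C p} =
        {q \<in> leaf_paths r. take (Suc l) q = take (Suc l) p}"
      using BC[OF p] cols by auto
    then show "real (col_mult (stack2 ?B ?C) 2 p) = path_sum (\<lambda>_. 1) (snd (p ! l))"
      using card_leaf_paths_extending[OF w(2)] l u len
      by (simp only: col_mult_stack2_2 path_sum_one)
  qed
  have ratio: "real (col_mult (stack2 ?B ?C) 2 p) / real (col_mult (stack2 ?B ?C) 1 p) =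
      real (col_mult (stack2 ?B ?C) 2 q) / real (col_mult (stack2 ?B ?C) 1 q)"
    if i: "i \<in> rows ?C" and pq: "p \<in> support ?C i" "q \<in> support ?C i" for i p q
  proof -
    have p: "p \<in> leaf_paths r" "i = \<theta> (p ! l)" and q: "q \<in> leaf_paths r" "i = \<theta> (q ! l)"
      using pq label_on_path_iff[OF _ l i] by (auto simp: support_tree_partition)
    note vp = nth_vertex[OF p(1) l] and vq = nth_vertex[OF q(1) l]
    have "floret (fst (p ! l)) = floret (fst (q ! l))"
      using floret_of_label[OF vp(4) vq(1)] in_floret[of "q ! l"] vq(4) p(2) q(2)
      by simp
    then have "path_sum (\<lambda>_. 1) (snd (p ! l)) * path_sum (\<lambda>_. 1) (fst (q ! l)) =
        path_sum (\<lambda>_. 1) (snd (q ! l)) * path_sum (\<lambda>_. 1) (fst (p ! l))"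
      using p(2) q(2) by (intro child_ratio[OF bal vp(1,2) vq(1,2)]) auto
    moreover have "path_sum (\<lambda>_. 1) (fst (p ! l)) > 0" "path_sum (\<lambda>_. 1) (fst (q ! l)) > 0"
      using path_sum_pos vp(1) vq(1) by auto
    ultimately show ?thesis unfolding mult[OF p(1)] mult[OF q(1)] by (simp add: field_simps)
  qed
  show ?thesis
    unfolding well_connected_def
  proof (intro ballI)
    fix k u p q
    assume k: "k \<in> {2..2::nat}" and u: "u \<in> rows (stack2 ?B ?C k)"
      and pq: "p \<in> support (stack2 ?B ?C k) u" "q \<in> support (stack2 ?B ?C k) u"
    have k2: "k = 2" using k by simp
    then obtain i where i: "i \<in> rows ?C" "u = Inr i"
      using u by (auto simp: stack2_def map_rows_def)
    then have "p \<in> support ?C i" "q \<in> support ?C i"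
      using pq k2 support_map_rows[of Inr ?C i] by (auto simp: stack2_def)
    from ratio[OF i(1) this]
    show "real (col_mult (stack2 ?B ?C) k p) / real (col_mult (stack2 ?B ?C) (k - 1) p) =
        real (col_mult (stack2 ?B ?C) k q) / real (col_mult (stack2 ?B ?C) (k - 1) q)"
      using k2 by simp
  qed
qed

section \<open>The rowspan condition\<close>

text \<open>Since \<open>v\<close> is not a leaf, each of its leaf paths has a first arc, whose
  label lies in \<open>floret u\<close> iff the two florets agree. All later arcs start at deeper
  levels, where stratification excludes the labels of \<open>floret u\<close>. So each product gains
  the same factor.\<close>

lemma path_sum_indicator:
  assumes u: "u \<in> pverts G" and v: "v \<in> pverts G" "\<not> leaf v" and lev: "level u = level v"
  shows "path_sum (\<lambda>s. if s \<in> floret u then 2 else 1) v =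
    (if floret v = floret u then 2 else 1) * path_sum (\<lambda>_. 1) v"
proof -
  let ?x = "\<lambda>s. if s \<in> floret u then 2 else 1 :: real"
  have "(\<Prod>e\<leftarrow>p. ?x (\<theta> e)) = (if floret v = floret u then 2 else 1) * (\<Prod>e\<leftarrow>p. 1)"
    if p: "p \<in> leaf_paths v" for p
  proof -
    obtain w q where q: "p = (v, w) # q" "w \<in> children v" "q \<in> leaf_paths w"
      using p leaf_paths_step[OF v] by auto
    have vw: "(v, w) \<in> parcs G" using q(2) by (simp add: children_def)
    obtain z where z: "awalk w q z" using q(3) by (auto simp: leaf_paths_def)
    have "?x (\<theta> e) = 1" if e: "e \<in> set q" for e
    proof -
      have eG: "e \<in> parcs G" using e z by (auto simp: awalk_def)
      have "level u < level (fst e)"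
        using level_le_along_walk[OF z e] level_arc[OF vw] lev by simp
      then have "floret (fst e) \<noteq> floret u"
        using strat u in_arcsD1[of "fst e" "snd e"] eG unfolding stratified_def by fastforce
      then show ?thesis using floret_of_label[OF eG u] by auto
    qed
    then have "map (\<lambda>e. ?x (\<theta> e)) q = map (\<lambda>_. 1) q" by simp
    moreover have "\<theta> (v, w) \<in> floret u \<longleftrightarrow> floret v = floret u"
      using floret_of_label[OF vw u] in_floret[OF vw] by auto
    ultimately show ?thesis by (simp add: q(1) cong: map_cong)
  qed
  then show ?thesis by (simp add: path_sum_def sum_distrib_left)
qed

text \<open>The row of label \<open>i\<close> in partition \<open>n\<close> receives the coefficient
  \<open>X (n - 1) i\<close>. A path meets just one row of each partition, so each inner sum
  collapses to a single term.\<close>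

lemma rowspan_tree:
  assumes F: "\<And>p. p \<in> leaf_paths r \<Longrightarrow> f p = (\<Sum>n<l. X n (\<theta> (p ! n)))" and l: "l \<le> tree_level"
  shows "restrict f (leaf_paths r) \<in> rowspan (stack tree_partition l)"
proof -
  let ?A = tree_partition
  have fin: "finite (rows (?A n))" if "n \<in> {1..l}" for n
    using tree_partition_multipartition[OF strat] l that
    by (auto simp: multipartition_matrix_def partition_matrix_def)
  have "(\<Sum>(n, i)\<in>(SIGMA n:{1..l}. rows (?A n)). X (n - 1) i * entry (?A n) i p) = f p"
    if p: "p \<in> leaf_paths r" for p
  proof -
    have "(\<Sum>i\<in>rows (?A (Suc n)). X n i * entry (?A (Suc n)) i p) = X n (\<theta> (p ! n))"
      if n: "n < l" for n
    proof -
      have "(\<Sum>i\<in>rows (?A (Suc n)). X n i * entry (?A (Suc n)) i p) =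
          (\<Sum>i\<in>rows (?A (Suc n)). if i = \<theta> (p ! n) then X n i else 0)"
        using label_on_path_iff[OF p, of n] n l by (intro sum.cong) simp_all
      also have "\<dots> = X n (\<theta> (p ! n))"
        using fin[of "Suc n"] nth_label_in_rows[OF p] n l by simp
      finally show ?thesis .
    qed
    then have "(\<Sum>n<l. \<Sum>i\<in>rows (?A (Suc n)). X n i * entry (?A (Suc n)) i p) = f p"
      using F[OF p] by simp
    moreover have "(\<Sum>n=1..l. \<Sum>i\<in>rows (?A n). X (n - 1) i * entry (?A n) i p) =
        (\<Sum>n<l. \<Sum>i\<in>rows (?A (Suc n)). X n i * entry (?A (Suc n)) i p)"
      by (rule sum.reindex_bij_witness[of _ Suc "\<lambda>n. n - 1"]) auto
    ultimately show ?thesis using fin by (subst sum.Sigma[symmetric]) auto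
  qed
  then have "restrict f (leaf_paths r) = restrict (\<lambda>j. \<Sum>i\<in>rows (stack ?A l).
      (\<lambda>(n, i). X (n - 1) i) i * entry (stack ?A l) i j) (cols (stack ?A l))"
    by (auto simp: stack_def case_prod_unfold fun_eq_iff)
  then show ?thesis unfolding rowspan_def by blast
qed

lemma floret_indicator_in_rowspan:
  assumes bal: balanced and l: "1 \<le> l" "l < tree_level"
    and u: "u \<in> pverts G" "level u = l"
  shows "restrict (\<lambda>p. if floret (fst (p ! l)) = floret u then 1 else 0) (leaf_paths r)
    \<in> rowspan (stack tree_partition l)"
proof -
  \<comment> \<open>The value 2 matches the base of the logarithm: the factors 2 and 1 from
    \<open>path_sum_indicator\<close> become 1 and 0.\<close>
  define x :: "'s \<Rightarrow> real" where "x = (\<lambda>s. if s \<in> floret u then 2 else 1)"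
  define h where "h v = log 2 (path_sum x v) - log 2 (path_sum (\<lambda>_. 1) v)" for v
  \<comment> \<open>\<open>X s\<close> is the increment of \<open>h\<close> along an arbitrary arc
    labelled \<open>s\<close>. That the choice does not matter follows from
    \<open>inc\<close>.\<close>
  define X where "X s = (let e = SOME e. e \<in> parcs G \<and> \<theta> e = s in h (snd e) - h (fst e))" for s
  have x_pos: "x s > 0" for s by (simp add: x_def)
  have pos: "path_sum x v > 0" "path_sum (\<lambda>_. 1) v > 0" if "v \<in> pverts G" for v
    using that by (auto intro!: path_sum_pos x_pos)
  \<comment> \<open>This is the logarithm of \<open>child_ratio\<close>. It is stated for every
    positive \<open>y\<close> because \<open>h\<close> combines the point \<open>x\<close> with the
    constant point 1.\<close>
  have inc: "log 2 (path_sum y (snd e)) - log 2 (path_sum y (fst e)) =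
      log 2 (path_sum y (snd e')) - log 2 (path_sum y (fst e'))"
    if y: "\<And>s. y s > 0" and e: "e \<in> parcs G" "e' \<in> parcs G" "\<theta> e = \<theta> e'" for y e e'
  proof -
    have v: "fst e \<in> pverts G" "fst e' \<in> pverts G" "snd e \<in> pverts G" "snd e' \<in> pverts G"
      "snd e \<in> children (fst e)" "snd e' \<in> children (fst e')"
      using e in_arcsD1[of "fst e" "snd e"] in_arcsD1[of "fst e'" "snd e'"]
        in_arcsD2[of "fst e" "snd e"] in_arcsD2[of "fst e'" "snd e'"] by (auto simp: children_def)
    have "floret (fst e) = floret (fst e')"
      using floret_of_label[OF e(1) v(2)] in_floret[of "e'"] e by simp
    then have "path_sum y (snd e) * path_sum y (fst e') = path_sum y (snd e') * path_sum y (fst e)"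
      using e(3) by (intro child_ratio[OF bal v(1,5,2,6)]) auto
    then have "log 2 (path_sum y (snd e) * path_sum y (fst e')) =
        log 2 (path_sum y (snd e') * path_sum y (fst e))" by simp
    moreover have "path_sum y (fst e) > 0" "path_sum y (fst e') > 0" "path_sum y (snd e) > 0"
      "path_sum y (snd e') > 0" using v y path_sum_pos by auto
    ultimately show ?thesis by (simp add: log_mult)
  qed
  have X: "X (\<theta> e) = h (snd e) - h (fst e)" if e: "e \<in> parcs G" for e
  proof -
    define e' where "e' = (SOME e'. e' \<in> parcs G \<and> \<theta> e' = \<theta> e)"
    have e': "e' \<in> parcs G" "\<theta> e' = \<theta> e"
      using someI[of "\<lambda>e'. e' \<in> parcs G \<and> \<theta> e' = \<theta> e" e] e by (auto simp: e'_def)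
    have "h (snd e') - h (fst e') = h (snd e) - h (fst e)"
      using inc[of x, OF x_pos e'(1) e e'(2)] inc[of "\<lambda>_. 1", OF _ e'(1) e e'(2)]
      by (simp add: h_def)
    then show ?thesis by (simp add: X_def e'_def)
  qed
  \<comment> \<open>Telescoping the increments leaves \<open>h (fst (p ! l)) - h r\<close>. The
    constant \<open>h r\<close> is charged to the term \<open>n = 0\<close>, which is present
    because \<open>1 \<le> l\<close>.\<close>
  have "(if floret (fst (p ! l)) = floret u then 1 else 0) =
      (\<Sum>n<l. X (\<theta> (p ! n)) + (if n = 0 then h r else 0))"
    if p: "p \<in> leaf_paths r" for p
  proof -
    obtain w where w: "awalk r p w" "length p = tree_level" using p by (rule leaf_path_obtain)
    have "(\<Sum>n<l. X (\<theta> (p ! n))) = (\<Sum>n<l. h (fst (p ! Suc n)) - h (fst (p ! n)))"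
      using nth_levels(1)[OF w(1)] consecutive_arcs[OF w(1)] w(2) l by (intro sum.cong) (auto simp: X)
    also have "\<dots> = h (fst (p ! l)) - h (fst (p ! 0))" by (rule sum_lessThan_telescope)
    also have "fst (p ! 0) = r" using first_vertex[OF w(1)] w(2) l by simp
    finally have "(\<Sum>n<l. X (\<theta> (p ! n)) + (if n = 0 then h r else 0)) = h (fst (p ! l))"
      using l by (simp add: sum.distrib)
    moreover have "h (fst (p ! l)) = (if floret (fst (p ! l)) = floret u then 1 else 0)"
    proof -
      note v = nth_vertex[OF p l(2)]
      have "\<not> leaf (fst (p ! l))" using v(1,2) by (auto simp: leaf_iff_floret floret_eq_image_children)
      with path_sum_indicator[OF u(1) v(1)] v(3) u(2)
      have "path_sum x (fst (p ! l)) =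
          (if floret (fst (p ! l)) = floret u then 2 else 1) * path_sum (\<lambda>_. 1) (fst (p ! l))"
        by (simp add: x_def)
      then show ?thesis using pos(2)[OF v(1)] by (simp add: h_def log_mult)
    qed
    ultimately show ?thesis by simp
  qed
  from rowspan_tree[where X = "\<lambda>n s. X s + (if n = 0 then h r else 0)", OF this]
  show ?thesis using l by simp
qed

lemma GRIP_tree:
  assumes balanced
  shows "GRIP tree_level tree_partition"
  unfolding GRIP_def
proof (intro ballI conjI)
  fix l assume "l \<in> {1..tree_level - 1}"
  then have l: "1 \<le> l" "l < tree_level" by auto
  let ?B = "big_cup tree_partition l" and ?C = "tree_partition (l + 1)"
  show "well_connected 2 (stack2 ?B ?C)" using well_connected_tree[OF assms l(2)] by simp
  show "floret_condition ?B ?C" using floret_condition_tree[OF l(2)] by simp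
  fix F assume "F \<in> rows (floret_cap ?B ?C)"
  then obtain q where q: "q \<in> leaf_paths r" and F: "F = floret (fst (q ! l))"
    using row_floret_tree l(2) by (auto simp: floret_cap_def big_cup_def)
  note v = nth_vertex[OF q l(2)]
  \<comment> \<open>The only row of \<open>?C\<close> met by \<open>p\<close> is the label of
    \<open>p ! l\<close>, and that label lies in \<open>F\<close> iff its source vertex has floret
    \<open>F\<close>. The row of \<open>floret_cap\<close> is thus the floret indicator.\<close>
  have "(\<exists>c\<in>F. p \<in> support ?C c) \<longleftrightarrow> floret (fst (p ! l)) = floret (fst (q ! l))"
    if p: "p \<in> leaf_paths r" for p
  proof -
    note w = nth_vertex[OF p l(2)]
    have "F \<subseteq> rows ?C"
      using row_floret_tree[OF q l(2)] unfolding F row_floret_def by auto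
    then have "(\<exists>c\<in>F. p \<in> support ?C c) \<longleftrightarrow> \<theta> (p ! l) \<in> F"
      using label_on_path_iff[OF p l(2)] p
      by (simp add: support_tree_partition subset_iff)
    also have "\<dots> \<longleftrightarrow> floret (fst (p ! l)) = floret (fst (q ! l))"
      using floret_of_label[OF w(4) v(1)] in_floret[of "p ! l"] w(4)
      unfolding F by auto
    finally show ?thesis .
  qed
  then have "row (floret_cap ?B ?C) F =
      restrict (\<lambda>p. if floret (fst (p ! l)) = floret (fst (q ! l)) then 1 else 0) (leaf_paths r)"
    by (auto simp: row_def floret_cap_def fun_eq_iff)
  then show "row (floret_cap ?B ?C) F \<in> rowspan (stack tree_partition l)"
    using floret_indicator_in_rowspan[OF assms l v(1,3)] by simp
qed

end

end

theorem theorem4p9: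
  fixes G :: "'v pair_pre_digraph" and r :: 'v
    and \<theta> :: "'v \<times> 'v \<Rightarrow> 's" and S :: "'s set"
  assumes "staged_tree G r \<theta> S"
    and "staged_tree.stratified G r \<theta>"
    and "staged_tree.balanced G \<theta>"
  shows "GRIP (rooted_tree.tree_level G r) (staged_tree.tree_partition G r \<theta> S)"
proof -
  interpret staged_tree G r \<theta> S by fact
  from assms(2,3) show ?thesis by (rule GRIP_tree)
qed

end
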